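(* Let $X$ and $Y$ be Banach spaces, let $\Delta\subset\mathbb{C}$ be a bounded open set, let $k_0\in\Delta$ and $r>0$ be such that $\Delta_0:=\{k\in\mathbb{C}: |k-k_0|\le r\}\subset\Delta$. For each $k\in\Delta$ let $A(k):X\to Y$ be a bounded linear operator and let $f(k)\in Y$. Assume: (a) for every $k\in\Delta_0$ the equation $A(k)u=g$ has a unique solution $u\in X$ for every $g\in Y$ (so that $A^{-1}(k):Y\to X$ is defined); (b) $f$ is continuous on $\Delta_0$ and $\sup_{k\in\Delta_0}\|f(k)\|\le c_0$ for some constant $c_0<\infty$; (c) for every bounded set $M\subset X$, $$\lim_{h\to 0}\ \sup_{k,\,k+h\in\Delta_0,\ v\in M}\|[A(k+h)-A(k)]v\|=0;$$ (d) for every bounded set $N\subset Y$ there is a constant $c_1=c_1(N)<\infty$ such that $$\sup_{k\in\Delta_0,\ g\in N}\|A^{-1}(k)g\|\le c_1 .$$ For $k\in\Delta_0$ let $u(k)\in X$ be the unique solution of $A(k)u(k)=f(k)$. Then for every $k\in\Delta_0$, $$\lim_{h\to 0,\ k+h\in\Delta_0}\|u(k+h)-u(k)\|=0 .$$ *)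

theory Defs
  imports "HOL-Analysis.Analysis"
begin

end

(* The difference w = u(k+h) - u(k) satisfies
     A(k+h) w = (f(k+h) - f(k)) - (A(k+h) - A(k)) u(k),
   whose right-hand side tends to 0 by (b) and by (c) with M = {u(k)}. Hypothesis (d) with N the
   closed unit ball bounds the operator norms of the inverses uniformly, hence w tends to 0. *)

theory Submission
  imports Defs
begin

text \<open>Rescaling \<open>T w\<close> to norm one places it in the unit ball, where
  \<open>bound\<close> applies; injectivity identifies the chosen preimage as the rescaled
  \<open>w\<close>, and linearity undoes the scaling. If \<open>T w = 0\<close> no rescaling is
  possible, but then injectivity forces \<open>w = 0\<close>. This turns a bound on inverses into a
  lower bound for \<open>T\<close>.\<close>

lemma norm_le_if_inv_bounded_on_unit_ball:
  fixes T :: "'a::real_normed_vector \<Rightarrow> 'b::real_normed_vector"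
  assumes "linear T" and "inj T"
    and bound: "\<And>g. g \<in> cball 0 1 \<Longrightarrow> norm (inv T g) \<le> C"
  shows "norm w \<le> C * norm (T w)"
proof (cases "T w = 0")
  case True
  then have "w = 0"
    using assms(1,2) by (metis injD linear_0)
  then show ?thesis
    using True by simp
next
  case False
  let ?s = "inverse (norm (T w))"
  have "inv T (?s *\<^sub>R T w) = ?s *\<^sub>R w"
    using assms(1,2) by (metis inv_f_f linear_scale)
  moreover have "norm (inv T (?s *\<^sub>R T w)) \<le> C"
    using False by (intro bound) simp
  ultimately show ?thesis
    using False by (simp add: field_simps)
qed

theorem theorem1p1:
  fixes A :: "complex \<Rightarrow> 'x::banach \<Rightarrow> 'y::banach"
    and f :: "complex \<Rightarrow> 'y"
    and u :: "complex \<Rightarrow> 'x"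
    and \<Delta> :: "complex set" and k\<^sub>0 :: complex and r c\<^sub>0 :: real
  assumes "open \<Delta>" and "bounded \<Delta>"
    and "k\<^sub>0 \<in> \<Delta>" and "r > 0" and "cball k\<^sub>0 r \<subseteq> \<Delta>"
    and "\<And>k. k \<in> \<Delta> \<Longrightarrow> bounded_linear (A k)"
    and a: "\<And>k g. k \<in> cball k\<^sub>0 r \<Longrightarrow> \<exists>!v. A k v = g"
    and b: "continuous_on (cball k\<^sub>0 r) f"
           "\<And>k. k \<in> cball k\<^sub>0 r \<Longrightarrow> norm (f k) \<le> c\<^sub>0"
    and c: "\<And>M. bounded M \<Longrightarrow>
              ((\<lambda>h. SUP (k, v) \<in> {k. k \<in> cball k\<^sub>0 r \<and> k + h \<in> cball k\<^sub>0 r} \<times> M.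
                      ennreal (norm (A (k + h) v - A k v))) \<longlongrightarrow> 0) (at 0)"
    and d: "\<And>N. bounded N \<Longrightarrow>
              \<exists>c\<^sub>1::real. \<forall>k \<in> cball k\<^sub>0 r. \<forall>g \<in> N. norm (inv (A k) g) \<le> c\<^sub>1"
    and u: "\<And>k. k \<in> cball k\<^sub>0 r \<Longrightarrow> A k (u k) = f k"
  shows "\<forall>k \<in> cball k\<^sub>0 r.
           ((\<lambda>h. norm (u (k + h) - u k)) \<longlongrightarrow> 0) (at 0 within {h. k + h \<in> cball k\<^sub>0 r})"
proof
  fix k
  assume k: "k \<in> cball k\<^sub>0 r"
  let ?F = "at 0 within {h. k + h \<in> cball k\<^sub>0 r}"
  have dom: "\<forall>\<^sub>F h in ?F. k + h \<in> cball k\<^sub>0 r"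
    by (simp add: eventually_at_filter)
  \<comment> \<open>One \<open>C\<close> serves the whole disc. This uniformity is essential,
    because the estimate is later used at the moving point \<open>k + h\<close>.\<close>
  obtain C where C: "\<And>k g. k \<in> cball k\<^sub>0 r \<Longrightarrow> g \<in> cball 0 1 \<Longrightarrow> norm (inv (A k) g) \<le> C"
    using d[OF bounded_cball] by metis
  have bl: "bounded_linear (A k)" if "k \<in> cball k\<^sub>0 r" for k
    using assms(5,6) that by blast
  have inv_bound: "norm w \<le> C * norm (A k w)" if "k \<in> cball k\<^sub>0 r" for k w
  proof (rule norm_le_if_inv_bounded_on_unit_ball)
    show "inj (A k)"
      using a[OF that] by (metis injI)
  qed (use bl C that in \<open>auto simp: bounded_linear.linear\<close>)
  have f_lim: "((\<lambda>h. norm (f (k + h) - f k)) \<longlongrightarrow> 0) ?F"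
  proof -
    have "(f \<longlongrightarrow> f k) (at k within cball k\<^sub>0 r)"
      using b(1) k by (simp add: continuous_on_def)
    \<comment> \<open>The target filter is punctured at \<open>k\<close>, so besides convergence one
      needs \<open>k + h\<close> to lie in the disc and to differ from \<open>k\<close>; the latter
      holds as \<open>h\<close> is nonzero.\<close>
    moreover have "filterlim (\<lambda>h. k + h) (at k within cball k\<^sub>0 r) ?F"
      unfolding filterlim_at
      by (intro conjI tendsto_eq_intros) (auto simp: eventually_at_filter)
    ultimately have "((\<lambda>h. f (k + h)) \<longlongrightarrow> f k) ?F"
      by (rule filterlim_compose)
    then show ?thesis
      using LIM_zero tendsto_norm_zero by blast
  qed
  have A_lim: "((\<lambda>h. norm (A (k + h) (u k) - A k (u k))) \<longlongrightarrow> 0) ?F"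
  proof -
    \<comment> \<open>The squeeze takes place in \<open>ennreal\<close>, where the supremum in
      \<open>c\<close> lives; the limit is carried back to the reals afterwards.\<close>
    have "((\<lambda>h. ennreal (norm (A (k + h) (u k) - A k (u k)))) \<longlongrightarrow> 0) ?F"
    proof (rule tendsto_sandwich[OF _ _ tendsto_const])
      show "((\<lambda>h. SUP (k, v) \<in> {k. k \<in> cball k\<^sub>0 r \<and> k + h \<in> cball k\<^sub>0 r} \<times> {u k}.
          ennreal (norm (A (k + h) v - A k v))) \<longlongrightarrow> 0) ?F"
        by (rule tendsto_within_subset[OF c]) auto
      show "\<forall>\<^sub>F h in ?F. ennreal (norm (A (k + h) (u k) - A k (u k))) \<le>
          (SUP (k, v) \<in> {k. k \<in> cball k\<^sub>0 r \<and> k + h \<in> cball k\<^sub>0 r} \<times> {u k}.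
            ennreal (norm (A (k + h) v - A k v)))"
        \<comment> \<open>The pair \<open>(k, u k)\<close> is an admissible index exactly because
          \<open>k + h\<close> also lies in the disc.\<close>
        using dom by eventually_elim (rule SUP_upper2[of "(k, u k)"], use k in auto)
    qed simp
    then show ?thesis
      using tendsto_ennreal_iff[of "\<lambda>h. norm (A (k + h) (u k) - A k (u k))" ?F 0] by simp
  qed
  have le: "norm (u (k + h) - u k) \<le>
      C * (norm (f (k + h) - f k) + norm (A (k + h) (u k) - A k (u k)))"
    if "k + h \<in> cball k\<^sub>0 r" for h
  proof -
    have "A (k + h) (u (k + h) - u k) = (f (k + h) - f k) - (A (k + h) (u k) - A k (u k))"
      using u[OF k] u[OF that] bl[OF that] by (simp add: linear_diff bounded_linear.linear)
    \<comment> \<open>At \<open>g = 0\<close> the constant dominates a norm. Its sign is what allows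
      the triangle inequality to be multiplied by \<open>C\<close>.\<close>
    moreover have "0 \<le> C"
      by (rule order_trans[OF norm_ge_zero C[OF k, of 0]]) simp
    ultimately show ?thesis
      by (metis (no_types) inv_bound[OF that] mult_left_mono[OF norm_triangle_ineq4] order_trans)
  qed
  show "((\<lambda>h. norm (u (k + h) - u k)) \<longlongrightarrow> 0) ?F"
  proof (rule tendsto_sandwich[OF _ _ tendsto_const])
    show "((\<lambda>h. C * (norm (f (k + h) - f k) + norm (A (k + h) (u k) - A k (u k)))) \<longlongrightarrow> 0) ?F"
      using tendsto_mult_right_zero[OF tendsto_add_zero[OF f_lim A_lim]] .
    show "\<forall>\<^sub>F h in ?F. norm (u (k + h) - u k) \<le>
        C * (norm (f (k + h) - f k) + norm (A (k + h) (u k) - A k (u k)))"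
      using dom by eventually_elim (rule le)
  qed simp
qed

end
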